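(* Let $T$ be a finite tree with vertex set $V$, $|V|\ge 2$, and with every edge carrying the label $1$. Let $(T^*,\alpha^* )$ be the generalized inverse of $T$. Then two distinct vertices $u,v\in V$ are joined by an edge $e=uv$ in $T^*$ if and only if $T$ contains a $u_Mv$ alternating path for some maximum matching $M$ of $T$, and in that case the label of $e$ is $\alpha^*(e)=\alpha^*(uv)=\mu_T(u,v)/m(T)$.
   Context: Adjacency matrix of $T$: the symmetric $(0,1)$-matrix $A$ indexed by $V$ with $uv$-th entry $1$ if $uv$ is an edge of $T$ and $0$ otherwise. Generalized inverse of a matrix: a real symmetric $n\times n$ matrix $A$ of rank $k$ can be written as $PAP^T=D$ with $P$ orthogonal and $D=\mathrm{diag}(\lambda_1,\ldots,\lambda_k,0,\ldots,0)$, where $\lambda_1,\ldots,\lambda_k$ are the non-zero eigenvalues of $A$. The generalized inverse of $A$ is $A^*=P^TD^*P$, where $D^*=\mathrm{diag}(\lambda_1^{-1},\ldots,\lambda_k^{-1},0,\ldots,0)$. (It coincides with the Moore–Penrose inverse of $A$.) Generalized inverse of a graph: if $A$ is the adjacency matrix of $T$, the generalized inverse of $T$ is the edge-labeled graph $(T^*,\alpha^* )$ (loops allowed) on the same vertex set $V$, in which $e=uv$ is an edge if and only if the $uv$-th entry of $A^*$ is non-zero, and then this entry is the label $\alpha^*(e)$. Matchings: a maximum matching is a matching of maximum cardinality; $m(T)$ is the total number of maximum matchings of $T$. For a matching $M$ of $T$ and distinct vertices $u,v$, a $u_Mv$ alternating path is a $u$–$v$ path in $T$ whose edges belong alternately to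 $M$ and not to $M$, such that the first and last edges (those incident to $u$ and to $v$) both belong to $M$ (a single edge of $M$ is allowed). For distinct $u,v$ at odd distance in $T$, $\sigma(u,v)=+1$ if the distance is congruent to $1$ mod $4$ and $\sigma(u,v)=-1$ if it is congruent to $-1$ mod $4$. For such a pair, $\mu_T(u,v)$ is $\sigma(u,v)$ times the number of maximum matchings $M$ of $T$ for which there exists a $u_Mv$ alternating path in $T$; otherwise (in particular if $u=v$ or the distance is even) $\mu_T(u,v)=0$. *)

theory Defs
  imports "HOL-Analysis.Analysis"
begin

text \<open>A simple graph on the vertex set \<open>UNIV :: 'v set\<close>, with \<open>'v\<close> a finite type, is given by its
  set \<open>E\<close> of edges, each edge being a two-element set of vertices.\<close>

definition simple_graph :: "'v::finite set set \<Rightarrow> bool" where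
  "simple_graph E \<longleftrightarrow> (\<forall>e\<in>E. card e = 2)"

definition path_edges :: "'v list \<Rightarrow> 'v set list" where
  "path_edges p = map (\<lambda>(x, y). {x, y}) (zip p (tl p))"

definition is_path :: "'v set set \<Rightarrow> 'v \<Rightarrow> 'v list \<Rightarrow> 'v \<Rightarrow> bool" where
  "is_path E u p v \<longleftrightarrow>
     p \<noteq> [] \<and> hd p = u \<and> last p = v \<and> distinct p \<and> set (path_edges p) \<subseteq> E"

definition is_cycle :: "'v set set \<Rightarrow> 'v list \<Rightarrow> bool" where
  "is_cycle E p \<longleftrightarrow> 3 \<le> length p \<and> distinct p \<and> set (path_edges (p @ [hd p])) \<subseteq> E"

definition is_tree :: "'v::finite set set \<Rightarrow> bool" where
  "is_tree E \<longleftrightarrow> simple_graph E \<and> (\<forall>u v. \<exists>p. is_path E u p v) \<and> (\<nexists>p. is_cycle E p)"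

definition graph_dist :: "'v set set \<Rightarrow> 'v \<Rightarrow> 'v \<Rightarrow> nat" where
  "graph_dist E u v = (LEAST k. \<exists>p. is_path E u p v \<and> length (path_edges p) = k)"

definition matching :: "'v set set \<Rightarrow> 'v set set \<Rightarrow> bool" where
  "matching E M \<longleftrightarrow> M \<subseteq> E \<and> pairwise disjnt M"

definition maximum_matching :: "'v set set \<Rightarrow> 'v set set \<Rightarrow> bool" where
  "maximum_matching E M \<longleftrightarrow> matching E M \<and> (\<forall>M'. matching E M' \<longrightarrow> card M' \<le> card M)"

definition num_maximum_matchings :: "'v::finite set set \<Rightarrow> nat" where
  "num_maximum_matchings E = card {M. maximum_matching E M}"

definition alternating_path :: "'v set set \<Rightarrow> 'v set set \<Rightarrow> 'v \<Rightarrow> 'v list \<Rightarrow> 'v \<Rightarrow> bool" where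
  "alternating_path E M u p v \<longleftrightarrow>
     u \<noteq> v \<and> is_path E u p v \<and>
     hd (path_edges p) \<in> M \<and> last (path_edges p) \<in> M \<and>
     successively (\<lambda>e f. e \<in> M \<longleftrightarrow> f \<notin> M) (path_edges p)"

text \<open>The sign is only meaningful, and only used, for vertices at odd distance.\<close>

definition dist_sign :: "'v set set \<Rightarrow> 'v \<Rightarrow> 'v \<Rightarrow> int" where
  "dist_sign E u v = (if graph_dist E u v mod 4 = 1 then 1 else - 1)"

definition mu :: "'v::finite set set \<Rightarrow> 'v \<Rightarrow> 'v \<Rightarrow> int" where
  "mu E u v =
     (if u \<noteq> v \<and> odd (graph_dist E u v)
      then dist_sign E u v *
             int (card {M. maximum_matching E M \<and> (\<exists>p. alternating_path E M u p v)})
      else 0)"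

definition diag_matrix :: "real ^ 'n \<Rightarrow> real ^ 'n ^ 'n" where
  "diag_matrix d = (\<chi> i j. if i = j then d $ i else 0)"

text \<open>The index type carries no order, so the zero eigenvalues are not required to come last.
  Since \<open>inverse 0 = 0\<close>, the matrix \<open>diag_matrix (\<chi> i. inverse (d $ i))\<close> inverts exactly the
  non-zero diagonal entries. The result does not depend on the diagonalization, and a
  diagonalization exists for every symmetric \<open>A\<close>.\<close>

definition is_generalized_inverse :: "real ^ 'n ^ 'n \<Rightarrow> real ^ 'n ^ 'n \<Rightarrow> bool" where
  "is_generalized_inverse A B \<longleftrightarrow>
     (\<exists>P d. orthogonal_matrix P \<and> P ** A ** transpose P = diag_matrix d \<and>
            B = transpose P ** diag_matrix (\<chi> i. inverse (d $ i)) ** P)"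

definition generalized_inverse :: "real ^ 'n ^ 'n \<Rightarrow> real ^ 'n ^ 'n" where
  "generalized_inverse A = (THE B. is_generalized_inverse A B)"

definition adjacency_matrix :: "'v::finite set set \<Rightarrow> real ^ 'v ^ 'v" where
  "adjacency_matrix E = (\<chi> u v. if {u, v} \<in> E then 1 else 0)"

text \<open>An edge-labelled graph is a set of edges with a labelling that is only meaningful on these
  edges; a loop at \<open>u\<close> is the edge \<open>{u, u} = {u}\<close>. The description in
  \<open>graph_of_matrix\<close> determines the labels because it is applied to symmetric matrices.\<close>

type_synonym 'v labelled_graph = "'v set set \<times> ('v set \<Rightarrow> real)"

definition graph_of_matrix :: "real ^ 'v ^ 'v \<Rightarrow> 'v::finite labelled_graph" where
  "graph_of_matrix B =
     ({{u, v} | u v. B $ u $ v \<noteq> 0}, \<lambda>e. THE x. \<exists>u v. e = {u, v} \<and> x = B $ u $ v)"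

definition generalized_inverse_graph :: "'v::finite set set \<Rightarrow> 'v labelled_graph" where
  "generalized_inverse_graph E = graph_of_matrix (generalized_inverse (adjacency_matrix E))"

end

theory Submission
  imports Defs
begin

text \<open>For every \<open>k\<close>, let \<open>X k\<close> (\<open>signed_alternating\<close>) be the matrix whose \<open>uv\<close>-th entry is the signed number
  of \<open>k\<close>-edge matchings for which the tree path from \<open>u\<close> to \<open>v\<close> alternates and has both end edges in
  the matching, and let \<open>W k\<close> (\<open>signed_deficient\<close>) count in the same way the \<open>k\<close>-edge matchings that
  miss \<open>v\<close> and for which the path alternates and starts with a matching edge. Let \<open>m k\<close> be the number
  of \<open>k\<close>-edge matchings and \<open>A\<close> the adjacency matrix. In row \<open>u\<close> of a product with \<open>A\<close>, the neighbour of
  \<open>u\<close> on the path to \<open>v\<close> contributes with the opposite sign to all other neighbours; after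
  cancellation only matchings missing \<open>u\<close> remain. Switching a matching along a path makes \<open>W k\<close>
  symmetric, and augmenting it yields \<open>A W k = X (k + 1)\<close>, while \<open>A X k = m k I - W k\<close>. For the maximum
  size \<open>k\<close> this gives \<open>A W k = 0\<close>, and \<open>X k = A W (k - 1)\<close> then gives \<open>W k X k = 0\<close>. Hence
  \<open>X k / m k\<close> satisfies the Penrose equations for \<open>A\<close>, which characterize the generalized inverse.\<close>

section \<open>Symmetric matrices and the Penrose equations\<close>

lemma matrix_mult_scaleR:
  fixes B C :: "real^'n^'n"
  shows "(c *\<^sub>R B) ** C = c *\<^sub>R (B ** C)" "B ** (c *\<^sub>R C) = c *\<^sub>R (B ** C)"
  by (simp_all add: scalar_matrix_assoc[symmetric] matrix_scalar_ac scalar_mult_eq_scaleR)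

lemma matrix_diff_mult: "(B - C) ** D = B ** D - C ** (D :: real^'n^'n)"
  by (simp add: matrix_matrix_mult_def vec_eq_iff left_diff_distrib sum_subtractf)

text \<open>A maximiser of the Rayleigh quotient on the unit sphere of \<open>S\<close> is an
  eigenvector; perturbing it along its own residual replaces differentiation.\<close>

lemma selfadjoint_eigenvector_exists:
  fixes f :: "'a::euclidean_space \<Rightarrow> 'a"
  assumes f: "linear f" "\<And>x y. f x \<bullet> y = x \<bullet> f y"
    and S: "subspace S" "f ` S \<subseteq> S" "S \<noteq> {0}"
  obtains x l where "x \<in> S" "norm x = 1" "f x = l *\<^sub>R x"
proof -
  obtain z where z: "z \<in> S" "z \<noteq> 0"
    using S subspace_0 by blast
  have "compact (S \<inter> sphere 0 1)"
    using S(1) by (simp add: closed_Int_compact closed_subspace)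
  moreover have "z /\<^sub>R norm z \<in> S \<inter> sphere 0 1"
    using z S(1) by (simp add: subspace_scale)
  moreover have "continuous_on (S \<inter> sphere 0 1) (\<lambda>x. f x \<bullet> x)"
    using f(1) by (intro continuous_intros linear_continuous_on) (simp add: linear_conv_bounded_linear)
  ultimately obtain x where x: "x \<in> S" "norm x = 1"
    and max: "\<And>y. y \<in> S \<Longrightarrow> norm y = 1 \<Longrightarrow> f y \<bullet> y \<le> f x \<bullet> x"
    using continuous_attains_sup[of "S \<inter> sphere 0 1" "\<lambda>x. f x \<bullet> x"]
    by (metis IntE IntI empty_iff mem_sphere_0)
  define l where "l = f x \<bullet> x"
  have quad: "f y \<bullet> y \<le> l * (y \<bullet> y)" if "y \<in> S" for y
  proof (cases "y = 0")
    case False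
    let ?w = "y /\<^sub>R norm y"
    have "f ?w \<bullet> ?w \<le> l"
      unfolding l_def using that False S(1) by (intro max) (auto simp: subspace_scale)
    moreover have "f ?w \<bullet> ?w = (f y \<bullet> y) / (y \<bullet> y)"
      using f(1) by (simp add: linear_scale dot_square_norm power2_eq_square field_simps)
    ultimately show ?thesis
      using False by (simp add: divide_le_eq)
  qed (use f(1) in \<open>simp add: linear_0\<close>)
  \<comment> \<open>The residual of the eigenvector equation lies in \<open>S\<close> by invariance;
    the aim is \<open>h = 0\<close>.\<close>
  define h where "h = f x - l *\<^sub>R x"
  define C where "C = l * (h \<bullet> h) - f h \<bullet> h"
  have h: "h \<in> S"
    unfolding h_def using x S by (auto intro!: subspace_diff subspace_scale)
  \<comment> \<open>In \<open>quad\<close> at \<open>x + t *\<^sub>R h\<close> the constant terms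
    cancel and the linear terms differ by \<open>2 * t * (h \<bullet> h)\<close>.\<close>
  have var: "2 * t * (h \<bullet> h) \<le> t\<^sup>2 * C" for t
  proof -
    have "f (x + t *\<^sub>R h) \<bullet> (x + t *\<^sub>R h) \<le> l * ((x + t *\<^sub>R h) \<bullet> (x + t *\<^sub>R h))"
      using x h S(1) by (intro quad) (simp add: subspace_add subspace_scale)
    moreover have fxh: "f x \<bullet> h = h \<bullet> h + l * (x \<bullet> h)"
      by (subst (2) h_def) (simp add: inner_diff_left)
    moreover have "f h \<bullet> x = h \<bullet> h + l * (x \<bullet> h)"
      using f(2)[of h x] fxh by (simp add: inner_commute)
    moreover have "x \<bullet> x = 1"
      using x(2) by (simp add: dot_square_norm)
    ultimately show ?thesis
      using f(1) unfolding C_def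
      by (simp add: linear_add linear_scale inner_add_left inner_add_right l_def[symmetric]
          power2_eq_square algebra_simps inner_commute[of h x])
  qed
  have "h \<bullet> h = 0"
  proof (rule ccontr)
    assume "h \<bullet> h \<noteq> 0"
    then have pos: "h \<bullet> h > 0"
      by simp
    \<comment> \<open>Small enough that \<open>t * C \<le> h \<bullet> h\<close>, against
      \<open>2 * (h \<bullet> h) \<le> t * C\<close>; the summand 1 keeps the denominator
      positive.\<close>
    define t where "t = (h \<bullet> h) / (\<bar>C\<bar> + 1)"
    have "t > 0"
      using pos by (simp add: t_def add_pos_nonneg)
    then have "2 * (h \<bullet> h) \<le> t * C"
      using var[of t] by (simp add: power2_eq_square)
    also have "\<dots> \<le> t * (\<bar>C\<bar> + 1)"
      using \<open>t > 0\<close> by (intro mult_left_mono) auto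
    also have "\<dots> = h \<bullet> h"
      by (simp add: t_def add_nonneg_eq_0_iff)
    finally show False
      using pos by simp
  qed
  then show thesis
    using x that[of x l] by (simp add: h_def)
qed

text \<open>Induction on the dimension: the orthogonal complement in \<open>S\<close> of an
  eigenvector is again invariant, since \<open>f\<close> is self-adjoint.\<close>

lemma selfadjoint_orthonormal_eigenbasis:
  fixes f :: "'a::euclidean_space \<Rightarrow> 'a"
  assumes f: "linear f" "\<And>x y. f x \<bullet> y = x \<bullet> f y"
    and S: "subspace S" "f ` S \<subseteq> S"
  shows "\<exists>B. B \<subseteq> S \<and> finite B \<and> card B = dim S \<and> pairwise orthogonal B \<and>
           (\<forall>x\<in>B. norm x = 1 \<and> (\<exists>l. f x = l *\<^sub>R x))"
  using S
proof (induction "dim S" arbitrary: S)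
  case 0
  then show ?case
    by (intro exI[of _ "{}"]) auto
next
  case (Suc n)
  then have "S \<noteq> {0}"
    by auto
  then obtain x l where x: "x \<in> S" "norm x = 1" "f x = l *\<^sub>R x"
    using selfadjoint_eigenvector_exists[OF f Suc.prems] by blast
  define S' where "S' = {y \<in> S. \<forall>z\<in>span {x}. orthogonal z y}"
  have S': "S' = {y \<in> S. orthogonal x y}"
    unfolding S'_def by (auto simp: span_singleton orthogonal_def dest: spec[of _ 1])
  have sub: "subspace S'"
    unfolding S' using Suc.prems(1)
    by (auto simp: subspace_def orthogonal_def inner_add_right)
  have "dim S' + dim (span {x}) = dim S"
    unfolding S'_def using Suc.prems(1) x(1)
    by (intro dim_subspace_orthogonal_to_vectors) (auto intro: span_minimal[THEN subsetD])
  moreover have "dim (span {x}) = 1"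
    using x(2) by (auto simp: dim_span dim_singleton)
  ultimately have "n = dim S'"
    using Suc.hyps(2) by simp
  moreover have "f ` S' \<subseteq> S'"
    using Suc.prems(2) f(2)[of x] by (auto simp: S' orthogonal_def x(3)) (metis mult_zero_right inner_scaleR_left)
  ultimately obtain B where B: "B \<subseteq> S'" "finite B" "card B = n" "pairwise orthogonal B"
    "\<And>y. y \<in> B \<Longrightarrow> norm y = 1 \<and> (\<exists>l. f y = l *\<^sub>R y)"
    using Suc.hyps(1)[of S'] sub by auto
  have "x \<notin> B"
    using B(1) x(2) by (auto simp: S' orthogonal_self)
  then show ?case
    using B x Suc.hyps(2)
    by (intro exI[of _ "insert x B"]) (auto simp: S' pairwise_insert orthogonal_commute)
qed

text \<open>The rows of \<open>P\<close> are an orthonormal eigenbasis, indexed by \<open>'n\<close>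
  through a bijection.\<close>

lemma symmetric_matrix_diagonalizable:
  fixes A :: "real^'n^'n"
  assumes A: "transpose A = A"
  obtains P d where "orthogonal_matrix P" "P ** A ** transpose P = diag_matrix d"
proof -
  have adj: "(A *v x) \<bullet> y = x \<bullet> (A *v y)" for x y
    using A by (metis dot_lmul_matrix vector_transpose_matrix)
  obtain B where B: "finite B" "card B = CARD('n)" "pairwise orthogonal B"
    "\<And>x. x \<in> B \<Longrightarrow> norm x = 1 \<and> (\<exists>l. A *v x = l *\<^sub>R x)"
    using selfadjoint_orthonormal_eigenbasis[of "(*v) A" UNIV] adj by auto
  obtain b :: "'n \<Rightarrow> real^'n" where b: "bij_betw b UNIV B"
    using finite_same_card_bij[of "UNIV :: 'n set" B] B by auto
  then have bB: "b i \<in> B" for i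
    by (auto simp: bij_betw_def)
  obtain l where l: "\<And>i. A *v b i = l i *\<^sub>R b i"
    using B(4)[OF bB] by metis
  have orth: "b i \<bullet> b j = (if i = j then 1 else 0)" for i j
  proof (cases "i = j")
    case True
    then show ?thesis
      using B(4)[OF bB[of j]] by (simp add: dot_square_norm)
  next
    case False
    then have "b i \<noteq> b j"
      using b by (auto simp: bij_betw_def inj_on_def)
    then show ?thesis
      using False B(3) bB by (auto simp: pairwise_def orthogonal_def)
  qed
  define P where "P = (\<chi> i. b i)"
  have "P ** transpose P = mat 1"
    by (simp add: vec_eq_iff matrix_matrix_mult_def transpose_def P_def mat_def orth
        flip: inner_vec_def[where 'a=real, simplified])
  then have "orthogonal_matrix P"
    by (metis matrix_left_right_inverse orthogonal_matrix_def)
  moreover have "P ** A ** transpose P = diag_matrix (\<chi> i. l i)"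
  proof -
    have "(P ** A ** transpose P) $ i $ j = b i \<bullet> (A *v b j)" for i j
      unfolding matrix_mul_assoc[symmetric]
      by (simp add: matrix_matrix_mult_def transpose_def P_def inner_vec_def matrix_vector_mult_def)
    then show ?thesis
      by (auto simp: vec_eq_iff diag_matrix_def l orth)
  qed
  ultimately show thesis
    using that by blast
qed

section \<open>Diagonal matrices and the Moore-Penrose equations\<close>

lemma transpose_diag_matrix [simp]: "transpose (diag_matrix d) = diag_matrix d"
  by (auto simp: diag_matrix_def transpose_def vec_eq_iff)

lemma diag_matrix_mult: "diag_matrix d ** diag_matrix e = diag_matrix (\<chi> i. d $ i * e $ i)"
  by (auto simp: diag_matrix_def matrix_matrix_mult_def vec_eq_iff if_distrib[of "\<lambda>x. x * _"] cong: if_cong)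

text \<open>Products and transposes alone characterize the inverse here, so a candidate can be
  verified without knowing any eigenvalue.\<close>

definition penrose_inverse :: "real^'n^'n \<Rightarrow> real^'n^'n \<Rightarrow> bool" where
  "penrose_inverse A B \<longleftrightarrow> A ** B ** A = A \<and> B ** A ** B = B \<and>
     transpose (A ** B) = A ** B \<and> transpose (B ** A) = B ** A"

text \<open>\<open>A ** B\<close> and \<open>A ** C\<close> are symmetric and absorb each other,
  hence agree; likewise \<open>B ** A\<close> and \<open>C ** A\<close>. Then
  \<open>B ** A ** B\<close> turns into \<open>C ** A ** C\<close>.\<close>

lemma penrose_inverse_unique:
  assumes "penrose_inverse A B" "penrose_inverse A C"
  shows "B = C"
proof -
  have "A ** B = transpose ((A ** C) ** (A ** B))"
    using assms by (metis penrose_inverse_def matrix_mul_assoc)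
  also have "\<dots> = (A ** B) ** (A ** C)"
    using assms by (simp add: matrix_transpose_mul[of "A ** C"] penrose_inverse_def)
  also have "\<dots> = A ** C"
    using assms by (metis penrose_inverse_def matrix_mul_assoc)
  finally have 1: "A ** B = A ** C" .
  have "B ** A = transpose ((B ** A) ** (C ** A))"
    using assms by (metis penrose_inverse_def matrix_mul_assoc)
  also have "\<dots> = (C ** A) ** (B ** A)"
    using assms by (simp add: matrix_transpose_mul[of "B ** A"] penrose_inverse_def)
  also have "\<dots> = C ** A"
    using assms by (metis penrose_inverse_def matrix_mul_assoc)
  finally have 2: "B ** A = C ** A" .
  have "B = B ** (A ** B)"
    using assms by (simp add: penrose_inverse_def matrix_mul_assoc)
  also have "\<dots> = C ** A ** C"
    using 1 2 by (simp add: matrix_mul_assoc)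
  also have "\<dots> = C"
    using assms by (simp add: penrose_inverse_def)
  finally show ?thesis .
qed

text \<open>Conjugation by \<open>P\<close> reduces the equations to diagonal entries, where
  \<open>inverse 0 = 0\<close> covers the zero eigenvalues.\<close>

lemma is_generalized_inverse_imp_penrose:
  assumes "is_generalized_inverse A B"
  shows "penrose_inverse A B"
proof -
  obtain P d where P: "orthogonal_matrix P" and d: "P ** A ** transpose P = diag_matrix d"
    and B: "B = transpose P ** diag_matrix (\<chi> i. inverse (d $ i)) ** P"
    using assms unfolding is_generalized_inverse_def by blast
  have cancel: "transpose P ** P = mat 1" "P ** transpose P = mat 1"
    using P by (auto simp: orthogonal_matrix_def)
  have A: "A = transpose P ** diag_matrix d ** P"
  proof -
    have "A = (transpose P ** P) ** A ** (transpose P ** P)"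
      by (simp add: cancel matrix_mul_lid matrix_mul_rid)
    then show ?thesis
      by (simp add: d[symmetric] matrix_mul_assoc)
  qed
  have mult: "(transpose P ** diag_matrix x ** P) ** (transpose P ** diag_matrix y ** P) =
      transpose P ** diag_matrix (\<chi> i. x $ i * y $ i) ** P" for x y
  proof -
    have "(transpose P ** diag_matrix x ** P) ** (transpose P ** diag_matrix y ** P) =
        transpose P ** diag_matrix x ** (P ** transpose P) ** diag_matrix y ** P"
      by (simp add: matrix_mul_assoc)
    also have "\<dots> = transpose P ** (diag_matrix x ** diag_matrix y) ** P"
      by (simp add: cancel matrix_mul_rid matrix_mul_assoc)
    finally show ?thesis
      by (simp add: diag_matrix_mult)
  qed
  have sym: "transpose (transpose P ** diag_matrix x ** P) = transpose P ** diag_matrix x ** P" for x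
    by (simp add: matrix_transpose_mul matrix_mul_assoc)
  have "(\<chi> i. d $ i * inverse (d $ i) * d $ i) = d"
    "(\<chi> i. inverse (d $ i) * d $ i * inverse (d $ i)) = (\<chi> i. inverse (d $ i))"
    by (auto simp: vec_eq_iff field_simps)
  then show ?thesis
    unfolding penrose_inverse_def by (simp add: A B mult sym)
qed

text \<open>Diagonalization gives existence and the Penrose equations give uniqueness, so the
  definite description is justified.\<close>

lemma generalized_inverse_eqI:
  assumes "transpose A = A" "penrose_inverse A B"
  shows "generalized_inverse A = B"
proof -
  obtain P d where "orthogonal_matrix P" "P ** A ** transpose P = diag_matrix d"
    using symmetric_matrix_diagonalizable[OF assms(1)] by blast
  then obtain C where C: "is_generalized_inverse A C"
    unfolding is_generalized_inverse_def by blast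
  have "C' = B" if "is_generalized_inverse A C'" for C'
    using that assms(2) is_generalized_inverse_imp_penrose penrose_inverse_unique by blast
  then show ?thesis
    unfolding generalized_inverse_def using C by (metis (mono_tags, lifting) the_equality)
qed

section \<open>Matchings alternating along a path\<close>

lemma path_edges_simps [simp]:
  "path_edges [] = []"
  "path_edges [x] = []"
  "path_edges (x # y # p) = {x, y} # path_edges (y # p)"
  by (simp_all add: path_edges_def)

lemma path_edges_append: "path_edges (p @ x # q) = path_edges (p @ [x]) @ path_edges (x # q)"
proof (induction p)
  case (Cons a p)
  then show ?case by (cases p) auto
qed simp

lemma path_edges_rev: "path_edges (rev p) = rev (path_edges p)"
proof (induction p rule: induct_list012)
  case (3 x y zs)
  have "path_edges (rev (x # y # zs)) = path_edges (rev (y # zs)) @ [{y, x}]"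
    using path_edges_append[of "rev zs" y "[x]"] by simp
  then show ?case
    using 3 by (simp add: insert_commute)
qed auto

lemma length_path_edges: "length (path_edges p) = length p - 1"
  by (simp add: path_edges_def)

lemma path_edges_subset: "e \<in> set (path_edges p) \<Longrightarrow> e \<subseteq> set p"
  by (induction p rule: induct_list012) auto

text \<open>Prescribing the status of the first edge makes alternation recursive, and switching
  along the path merely negates \<open>b\<close>.\<close>

fun alternates :: "bool \<Rightarrow> 'v set set \<Rightarrow> 'v list \<Rightarrow> bool" where
  "alternates b M (x # y # p) \<longleftrightarrow> ({x, y} \<in> M) = b \<and> alternates (\<not> b) M (y # p)"
| "alternates b M p \<longleftrightarrow> True"

lemma alternates_snoc:
  "alternates b M (p @ [x, y]) \<longleftrightarrow> alternates b M (p @ [x]) \<and> ({x, y} \<in> M) = (b = even (length p))"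
proof (induction p arbitrary: b)
  case (Cons a p)
  then show ?case by (cases p) auto
qed simp

text \<open>An odd number of vertices means an even number of edges, and then the first and last
  edge, if any, have opposite status.\<close>

lemma alternates_rev: "alternates b M (rev p) = alternates (if odd (length p) then \<not> b else b) M p"
proof (induction p arbitrary: b rule: induct_list012)
  case (3 x y zs)
  have "alternates b M (rev (x # y # zs)) \<longleftrightarrow>
      alternates b M (rev (y # zs)) \<and> ({x, y} \<in> M) = (b = even (length zs))"
    using alternates_snoc[of b M "rev zs" y x] by (simp add: insert_commute)
  then show ?case
    using 3(2)[of b] by auto
qed auto

lemma alternates_cong:
  "(\<And>e. e \<in> set (path_edges p) \<Longrightarrow> e \<in> M \<longleftrightarrow> e \<in> N) \<Longrightarrow> alternates b M p = alternates b N p"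
  by (induction b M p rule: alternates.induct) auto

lemma alternates_sym_diff:
  "set (path_edges p) \<subseteq> F \<Longrightarrow> alternates b (sym_diff M F) p = alternates (\<not> b) M p"
  by (induction b M p rule: alternates.induct) auto

lemma successively_path_edges:
  "successively (\<lambda>e f. e \<in> M \<longleftrightarrow> f \<notin> M) (path_edges (x # y # p)) \<longleftrightarrow>
     alternates ({x, y} \<in> M) M (x # y # p)"
proof (induction p arbitrary: x y)
  case (Cons z p)
  have "alternates ({y, z} \<in> M) M (y # z # p) \<longleftrightarrow> alternates ({x, y} \<notin> M) M (y # z # p)"
    if "{x, y} \<in> M \<longleftrightarrow> {y, z} \<notin> M"
    using that by auto
  then show ?case
    using Cons[of y z] by auto
qed simp

lemma last_path_edges_in_iff:
  "alternates b M p \<Longrightarrow> 2 \<le> length p \<Longrightarrow> last (path_edges p) \<in> M \<longleftrightarrow> b = even (length p)"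
proof (induction p arbitrary: b rule: induct_list012)
  case (3 x y zs)
  then show ?case by (cases zs) auto
qed auto

lemma alternating_path_iff:
  "alternating_path E M u p v \<longleftrightarrow>
     u \<noteq> v \<and> is_path E u p v \<and> even (length p) \<and> alternates True M p"
\<comment> \<open>This rule serves only to split lists by length 0, 1 and at least 2.\<close>
proof (cases p rule: remdups_adj.cases)
  case (3 x y q)
  then show ?thesis
    using successively_path_edges[of M x y q] last_path_edges_in_iff[of True M p]
    by (auto simp: alternating_path_def)
qed (auto simp: alternating_path_def is_path_def)

section \<open>Switching and augmenting matchings of fixed size\<close>

definition misses :: "'v set set \<Rightarrow> 'v \<Rightarrow> bool" where
  "misses M x \<longleftrightarrow> (\<forall>e\<in>M. x \<notin> e)"

definition matchings :: "'v set set \<Rightarrow> nat \<Rightarrow> 'v set set set" where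
  "matchings E k = {M. matching E M \<and> card M = k}"

lemma matching_unique: "matching E M \<Longrightarrow> e \<in> M \<Longrightarrow> f \<in> M \<Longrightarrow> x \<in> e \<Longrightarrow> x \<in> f \<Longrightarrow> e = f"
  by (auto simp: matching_def pairwise_def disjnt_iff)

lemma matching_insert:
  assumes "matching E M" "{x, y} \<in> E" "misses M x" "misses M y"
  shows "matching E (insert {x, y} M)"
  using assms by (auto simp: matching_def pairwise_insert misses_def disjnt_iff)

lemma matching_subset: "matching E M \<Longrightarrow> N \<subseteq> M \<Longrightarrow> matching E N"
  by (auto simp: matching_def intro: pairwise_subset)

text \<open>The missed vertex slides along the path two edges at a time: exchanging the second edge
  for the first frees the third vertex, where the induction continues. The claim on vertices off the
  path is needed for augmentation.\<close>

lemma matching_switch: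
  fixes E :: "'v::finite set set"
  assumes "M \<in> matchings E k" "distinct p" "set (path_edges p) \<subseteq> E" "odd (length p)"
    "misses M (hd p)" "alternates False M p"
  shows "sym_diff M (set (path_edges p)) \<in> matchings E k \<and>
    misses (sym_diff M (set (path_edges p))) (last p) \<and>
    (\<forall>x. x \<notin> set p \<longrightarrow> misses M x \<longrightarrow> misses (sym_diff M (set (path_edges p))) x)"
  using assms
proof (induction p arbitrary: M rule: induct_list012)
  case (3 u y zs)
  then obtain z r where zs: "zs = z # r"
    by (cases zs) auto
  let ?F = "set (path_edges (z # r))"
  define N where "N = insert {u, y} (M - {{y, z}})"
  have M: "matching E M" "card M = k" "{u, y} \<notin> M" "{y, z} \<in> M" "misses M u"
    and E: "{u, y} \<in> E" "?F \<subseteq> E"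
    and dist: "u \<noteq> y" "u \<noteq> z" "y \<noteq> z" "u \<notin> set r" "y \<notin> set r" "distinct (z # r)"
    and alt: "alternates False M (z # r)" and "odd (length (z # r))"
    using 3(3-) unfolding zs by (auto simp: matchings_def)
  have sub: "misses (M - {{y, z}}) u" "misses (M - {{y, z}}) y" "misses (M - {{y, z}}) z"
    using M(5) matching_unique[OF M(1) _ M(4)] by (auto simp: misses_def)
  have "matching E N"
    unfolding N_def using sub M(1) E(1) by (intro matching_insert) (auto intro: matching_subset)
  moreover have "card N = k"
  proof -
    have "card M > 0"
      using M(4) by (auto simp: card_gt_0_iff)
    then show ?thesis
      unfolding N_def using M(2,3,4) by simp
  qed
  ultimately have "N \<in> matchings E k"
    by (simp add: matchings_def)
  moreover have "misses N z"
    using sub(3) dist by (auto simp: N_def misses_def)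
  \<comment> \<open>The exchanged edges do not recur in the rest of the path, so \<open>N\<close>
    and \<open>M\<close> agree there.\<close>
  moreover have notF: "{u, y} \<notin> ?F" "{y, z} \<notin> ?F"
    using dist path_edges_subset[of "{u, y}" "z # r"] path_edges_subset[of "{y, z}" "z # r"]
    by auto
  then have "alternates False N (z # r)"
    using alt by (subst alternates_cong[of _ N M]) (auto simp: N_def)
  ultimately have IH: "sym_diff N ?F \<in> matchings E k" "misses (sym_diff N ?F) (last (z # r))"
    "\<And>x. x \<notin> set (z # r) \<Longrightarrow> misses N x \<Longrightarrow> misses (sym_diff N ?F) x"
    using 3(1)[of N] E(2) dist(6) \<open>odd (length (z # r))\<close> by (auto simp: zs)
  have eq: "sym_diff N ?F = sym_diff M (set (path_edges (u # y # zs)))"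
    using notF M(3,4) dist(2) by (auto simp: zs N_def doubleton_eq_iff)
  have "misses (sym_diff N ?F) x" if "x \<notin> set (u # y # zs)" "misses M x" for x
    using that by (intro IH(3)) (auto simp: zs N_def misses_def)
  then show ?case
    using IH(1,2) unfolding eq by (simp add: zs)
qed auto

lemma sym_diff_cancel: "sym_diff (sym_diff M F) F = M"
  by auto

text \<open>Switching is its own inverse; it flips the alternation and moves the missed vertex to
  the other end.\<close>

lemma card_switch:
  fixes E :: "'v::finite set set"
  assumes p: "distinct p" "set (path_edges p) \<subseteq> E" "odd (length p)"
  shows "card {M \<in> matchings E k. misses M (last p) \<and> alternates True M p} =
         card {M \<in> matchings E k. misses M (hd p) \<and> alternates False M p}" (is "card ?S = card ?T")
proof -
  let ?t = "\<lambda>M. sym_diff M (set (path_edges p))"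
  have "?t M \<in> ?S" if "M \<in> ?T" for M
    using that matching_switch[of M E k p] p by (simp add: alternates_sym_diff)
  \<comment> \<open>Read backwards, the path starts at the missed vertex and, by its odd length,
    alternates from a non-matching edge.\<close>
  moreover have "?t M \<in> ?T" if "M \<in> ?S" for M
    using that matching_switch[of M E k "rev p"] p
    by (simp add: alternates_sym_diff alternates_rev path_edges_rev hd_rev last_rev)
  ultimately have "bij_betw ?t ?S ?T"
    by (intro bij_betw_byWitness[where f' = ?t]) (auto simp only: sym_diff_cancel)
  then show ?thesis
    by (rule bij_betw_same_card)
qed

text \<open>The first edge of the path already covers \<open>y\<close>; the last hypothesis handles
  the path without edges.\<close>

lemma alternates_imp_notin:
  assumes "matching E M" "x \<notin> set (y # p)" "alternates True M (y # p)" "p = [] \<Longrightarrow> misses M y"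
  shows "{x, y} \<notin> M"
proof (cases p)
  case (Cons z q)
  then have "{y, z} \<in> M" "x \<noteq> y" "x \<noteq> z"
    using assms by auto
  then show ?thesis
    using matching_unique[OF assms(1), of "{x, y}" "{y, z}" y] by (auto simp: doubleton_eq_iff)
qed (use assms in \<open>auto simp: misses_def\<close>)

text \<open>Augmentation along a path with both ends missed, split into a switch of the path without
  its first edge and the insertion of that edge.\<close>

lemma card_augment:
  fixes E :: "'v::finite set set"
  assumes p: "distinct p" "set (path_edges p) \<subseteq> E" "even (length p)" "p \<noteq> []"
  shows "card {M \<in> matchings E k. misses M (last p) \<and> misses M (hd p) \<and> alternates False M p} =
         card {M \<in> matchings E (Suc k). alternates True M p}" (is "card ?S = card ?T")
proof -
  obtain x y r where p_eq: "p = x # y # r"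
    using p by (cases p rule: remdups_adj.cases) auto
  let ?p = "y # r"
  let ?F = "set (path_edges ?p)"
  let ?t = "\<lambda>M. sym_diff M (set (path_edges p))"
  have notF: "{x, y} \<notin> ?F"
    using p(1) path_edges_subset[of "{x, y}" ?p] by (auto simp: p_eq)
  have p': "distinct ?p" "?F \<subseteq> E" "odd (length ?p)" "x \<notin> set ?p" "{x, y} \<in> E"
    using p by (auto simp: p_eq)
  have "?t M \<in> ?T" if "M \<in> ?S" for M
  proof -
    have M: "M \<in> matchings E k" "misses M (last ?p)" "misses M x" "alternates True M ?p" "{x, y} \<notin> M"
      using that by (auto simp: p_eq)
    let ?N = "sym_diff M ?F"
    \<comment> \<open>The switch runs backwards from the missed last vertex and so frees
      \<open>y\<close>; \<open>x\<close> stays missed, being off \<open>?p\<close>.\<close>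
    have N: "?N \<in> matchings E k" "misses ?N y" "misses ?N x"
      using matching_switch[of M E k "rev ?p"] p' M
      by (simp_all add: alternates_rev path_edges_rev hd_rev last_rev del: rev.simps)
    have "?t M = insert {x, y} ?N"
      using M(5) notF by (auto simp: p_eq)
    moreover have "{x, y} \<notin> ?N"
      using notF M(5) by auto
    ultimately have "?t M \<in> matchings E (Suc k)"
      using N p' matching_insert[of E ?N x y] by (simp add: matchings_def)
    then show ?thesis
      using that by (simp add: alternates_sym_diff)
  qed
  moreover have "?t M \<in> ?S" if "M \<in> ?T" for M
  proof -
    have M: "matching E M" "card M = Suc k" "alternates False M ?p" "{x, y} \<in> M"
      using that by (auto simp: p_eq matchings_def)
    \<comment> \<open>Undoing the augmentation: dropping the first edge frees \<open>y\<close>, and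
      the rest is switched from there.\<close>
    let ?N = "M - {{x, y}}"
    have N: "?N \<in> matchings E k" "misses ?N x" "misses ?N y"
      using M(1,2,4) matching_unique[OF M(1) _ M(4)] matching_subset[OF M(1), of ?N]
      by (auto simp: matchings_def misses_def)
    have "alternates False ?N ?p"
      using M(3) notF by (subst alternates_cong[of _ _ M]) auto
    then have sw: "sym_diff ?N ?F \<in> matchings E k" "misses (sym_diff ?N ?F) (last ?p)"
      "misses (sym_diff ?N ?F) x"
      using matching_switch[of ?N E k ?p] N p' by auto
    have eq: "?t M = sym_diff ?N ?F"
      using M(4) notF by (auto simp: p_eq)
    have "alternates False (?t M) p"
      using that by (simp add: alternates_sym_diff)
    moreover have "?t M \<in> matchings E k" "misses (?t M) (last p)" "misses (?t M) (hd p)"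
      using sw unfolding eq by (simp_all add: p_eq)
    ultimately show ?thesis
      by blast
  qed
  ultimately have "bij_betw ?t ?S ?T"
    by (intro bij_betw_byWitness[where f' = ?t]) (auto simp only: sym_diff_cancel)
  then show ?thesis
    by (rule bij_betw_same_card)
qed

text \<open>A matching covering \<open>u\<close> has exactly one edge at \<open>u\<close>, so the
  summands count disjoint classes.\<close>

lemma sum_card_matchings:
  fixes E :: "'v::finite set set"
  assumes simple: "simple_graph E"
  shows "(\<Sum>x | {u, x} \<in> E. card {M \<in> matchings E k. {u, x} \<in> M \<and> Q M}) =
         card {M \<in> matchings E k. \<not> misses M u \<and> Q M}"
proof -
  let ?A = "\<lambda>x. {M \<in> matchings E k. {u, x} \<in> M \<and> Q M}"
  have "\<exists>x. {u, x} \<in> E \<and> M \<in> ?A x" if M: "M \<in> matchings E k" "\<not> misses M u" "Q M" for M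
  proof -
    obtain e where e: "e \<in> M" "u \<in> e" "e \<in> E"
      using M by (auto simp: misses_def matchings_def matching_def)
    then obtain a b where "e = {a, b}"
      using simple by (auto simp: simple_graph_def card_2_iff)
    then have "e = {u, a} \<or> e = {u, b}"
      using e(2) by auto
    then show ?thesis
      using e M by blast
  qed
  moreover have "\<not> misses M u" if "{u, x} \<in> M" for x M
    using that by (auto simp: misses_def)
  ultimately have eq: "{M \<in> matchings E k. \<not> misses M u \<and> Q M} = (\<Union>x\<in>{x. {u, x} \<in> E}. ?A x)"
    by (intro equalityI subsetI) auto
  have uniq: "x = x'" if "M \<in> ?A x" "M \<in> ?A x'" for M x x'
    using that matching_unique[of E M "{u, x}" "{u, x'}" u]
    by (auto simp: matchings_def doubleton_eq_iff)
  have "card (\<Union>x\<in>{x. {u, x} \<in> E}. ?A x) = (\<Sum>x | {u, x} \<in> E. card (?A x))"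
  proof (intro card_UN_disjoint ballI impI equals0I)
    show "False" if "x \<noteq> x'" "M \<in> ?A x \<inter> ?A x'" for x x' M
      using that uniq[of M x x'] by simp
  qed simp_all
  then show ?thesis
    unfolding eq by simp
qed

section \<open>Paths in trees and the matrix identities\<close>

lemma is_path_Cons:
  "is_path E u (x # y # p) v \<longleftrightarrow> x = u \<and> {x, y} \<in> E \<and> x \<notin> set (y # p) \<and> is_path E y (y # p) v"
  by (auto simp: is_path_def)

lemma is_path_rev: "is_path E u p v \<Longrightarrow> is_path E v (rev p) u"
  by (simp add: is_path_def path_edges_rev hd_rev last_rev)

locale tree =
  fixes E :: "'v::finite set set"
  assumes tree: "is_tree E"
begin

lemma simple: "simple_graph E"
  using tree by (simp add: is_tree_def)

lemma adjacent_neq: "{x, y} \<in> E \<Longrightarrow> x \<noteq> y"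
  using simple by (force simp: simple_graph_def)

text \<open>Otherwise the path from \<open>u\<close> to \<open>x\<close> and the edge back to
  \<open>u\<close> form a cycle, of length at least 3 because \<open>x \<noteq> y\<close>.\<close>

lemma adjacent_notin_path:
  assumes p: "is_path E u (u # y # r) v" and x: "{u, x} \<in> E" "x \<noteq> y"
  shows "x \<notin> set (u # y # r)"
proof
  assume "x \<in> set (u # y # r)"
  then have "x \<in> set r"
    using x adjacent_neq by auto
  then obtain s t where r: "r = s @ x # t"
    by (meson split_list)
  let ?c = "u # y # s @ [x]"
  have "path_edges (u # y # r) = path_edges ?c @ path_edges (x # t)"
    using path_edges_append[of "u # y # s" x t] by (simp add: r)
  moreover have "path_edges (?c @ [hd ?c]) = path_edges ?c @ [{x, u}]"
    using path_edges_append[of "u # y # s" x "[u]"] by simp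
  ultimately have "is_cycle E ?c"
    using p x(1) by (auto simp: is_cycle_def is_path_def r insert_commute)
  then show False
    using tree by (auto simp: is_tree_def)
qed

text \<open>If the second vertices differ, prepending \<open>z\<close> to \<open>p\<close> gives a
  path from \<open>z\<close>; by induction it equals \<open>z # q\<close>, which avoids
  \<open>u\<close>, a contradiction.\<close>

lemma path_unique: "is_path E u p v \<Longrightarrow> is_path E u q v \<Longrightarrow> p = q"
proof (induction q arbitrary: u p rule: induct_list012)
  case 1
  then show ?case by (simp add: is_path_def)
next
  case (2 x)
  then show ?case
    by (cases p rule: remdups_adj.cases) (auto simp: is_path_def split: if_splits)
next
  case (3 x z q)
  then have xz: "x = u" "{u, z} \<in> E" "u \<notin> set (z # q)" and zq: "is_path E z (z # q) v"
    by (auto simp: is_path_Cons)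
  have "u \<noteq> v"
    using 3(4) by (auto simp: is_path_def split: if_splits)
  then obtain y r where p: "p = u # y # r"
    using 3(3) by (cases p rule: remdups_adj.cases) (auto simp: is_path_def)
  show ?case
  proof (cases "z = y")
    case True
    then show ?thesis
      using 3(2)[of z "y # r"] 3(3) zq xz p by (auto simp: is_path_Cons)
  next
    case False
    then have "is_path E z (z # u # y # r) v"
      using adjacent_notin_path[of u y r v z] 3(3) xz p
      by (auto simp: is_path_Cons insert_commute)
    then have "z # u # y # r = z # q"
      using 3(2) zq by blast
    then show ?thesis
      using xz by auto
  qed
qed

definition tree_path :: "'v \<Rightarrow> 'v \<Rightarrow> 'v list" where
  "tree_path u v = (THE p. is_path E u p v)"

lemma tree_path_eq: "is_path E u p v \<Longrightarrow> tree_path u v = p"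
  unfolding tree_path_def using path_unique by blast

lemma is_path_tree_path: "is_path E u (tree_path u v) v"
  using tree tree_path_eq unfolding is_tree_def by metis

lemma tree_path_props:
  "tree_path u v \<noteq> []" "hd (tree_path u v) = u" "last (tree_path u v) = v"
  "distinct (tree_path u v)" "set (path_edges (tree_path u v)) \<subseteq> E"
  using is_path_tree_path[of u v] by (auto simp: is_path_def)

lemma tree_path_self [simp]: "tree_path u u = [u]"
  by (intro tree_path_eq) (simp add: is_path_def)

lemma tree_path_rev: "tree_path v u = rev (tree_path u v)"
  using is_path_tree_path is_path_rev tree_path_eq by metis

lemma tree_path_neq:
  assumes "u \<noteq> v"
  obtains y r where "tree_path u v = u # y # r"
  using assms tree_path_props[of u v] by (cases "tree_path u v" rule: remdups_adj.cases) auto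

lemma tree_path_adjacent: "{u, x} \<in> E \<Longrightarrow> tree_path x u = [x, u]"
  by (intro tree_path_eq) (auto simp: is_path_def insert_commute adjacent_neq)

text \<open>Every neighbour of \<open>u\<close> other than \<open>y\<close> reaches \<open>v\<close>
  through \<open>u\<close>; hence \<open>y\<close> plays a special part in the row sums.\<close>

lemma tree_path_step:
  assumes "tree_path u v = u # y # r"
  shows "{u, y} \<in> E" "tree_path y v = y # r"
    "{u, x} \<in> E \<Longrightarrow> x \<noteq> y \<Longrightarrow> tree_path x v = x # u # y # r"
proof -
  have p: "is_path E u (u # y # r) v"
    using assms is_path_tree_path by metis
  then show "{u, y} \<in> E" "tree_path y v = y # r"
    by (auto simp: is_path_Cons intro: tree_path_eq)
  show "tree_path x v = x # u # y # r" if "{u, x} \<in> E" "x \<noteq> y"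
    using adjacent_notin_path[OF p that] p that
    by (intro tree_path_eq) (auto simp: is_path_Cons insert_commute)
qed

lemma graph_dist_eq: "graph_dist E u v = length (tree_path u v) - 1"
proof -
  have "(\<exists>p. is_path E u p v \<and> length (path_edges p) = k) \<longleftrightarrow> k = length (tree_path u v) - 1" for k
    using is_path_tree_path[of u v] tree_path_eq[of u _ v] length_path_edges by metis
  then show ?thesis
    unfolding graph_dist_def by (simp add: Least_equality)
qed

lemma alternating_path_tree_iff:
  "(\<exists>p. alternating_path E M u p v) \<longleftrightarrow>
     u \<noteq> v \<and> even (length (tree_path u v)) \<and> alternates True M (tree_path u v)"
  unfolding alternating_path_iff using is_path_tree_path[of u v] tree_path_eq[of u _ v] by metis

text \<open>The length of a path counts its vertices, so it exceeds the distance \<open>d\<close> by one. For odd \<open>d\<close>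
  the sign \<open>\<sigma>(u, v)\<close> is therefore \<open>- path_sign u v\<close>, while for even \<open>d\<close> the value of \<open>path_sign\<close> is
  \<open>(-1) ^ (d div 2)\<close>. Likewise \<open>alternates True M p\<close> has its last edge in \<open>M\<close> iff the length of
  \<open>p\<close> is even.\<close>

definition path_sign :: "'v \<Rightarrow> 'v \<Rightarrow> real" where
  "path_sign u v = (-1) ^ (length (tree_path u v) div 2)"

text \<open>All terms count matchings with property \<open>Q\<close> below. The term of
  \<open>y\<close> counts all of them; each other \<open>x\<close> counts those containing
  \<open>{u, x}\<close>, with opposite sign as its path has two more vertices. What survives is
  \<open>Q\<close> with \<open>u\<close> missed.\<close>

lemma sum_neighbours_alternating:
  assumes p: "tree_path u w = u # y # r"
    and R: "\<And>M. M \<in> matchings E k \<Longrightarrow> R M \<Longrightarrow> alternates True M (y # r) \<Longrightarrow> {u, y} \<notin> M"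
  shows "(\<Sum>x | {u, x} \<in> E.
            path_sign x w * real (card {M \<in> matchings E k. R M \<and> alternates True M (tree_path x w)})) =
         path_sign y w *
           real (card {M \<in> matchings E k. R M \<and> misses M u \<and> alternates False M (tree_path u w)})"
proof -
  let ?s = "path_sign y w"
  define Q where "Q M \<longleftrightarrow> R M \<and> {u, y} \<notin> M \<and> alternates True M (y # r)" for M
  define c where "c x = card {M \<in> matchings E k. {u, x} \<in> M \<and> Q M}" for x
  let ?f = "\<lambda>x. path_sign x w * real (card {M \<in> matchings E k. R M \<and> alternates True M (tree_path x w)})"
  note st = tree_path_step[OF p]
  have fx: "?f x = - ?s * real (c x)" if "{u, x} \<in> E" "x \<noteq> y" for x
  proof -
    have "{M \<in> matchings E k. R M \<and> alternates True M (tree_path x w)} =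
          {M \<in> matchings E k. {u, x} \<in> M \<and> Q M}"
      using st(3)[OF that] by (auto simp: Q_def insert_commute)
    moreover have "path_sign x w = - ?s"
      using st(2) st(3)[OF that] by (simp add: path_sign_def)
    ultimately show ?thesis
      by (simp add: c_def)
  qed
  \<comment> \<open>This allows \<open>y\<close> to rejoin the sum, so that
    \<open>sum_card_matchings\<close> applies to all neighbours.\<close>
  have cy: "c y = 0"
    by (simp add: c_def Q_def)
  have "?f y = ?s * real (card {M \<in> matchings E k. Q M})"
  proof -
    have "{M \<in> matchings E k. R M \<and> alternates True M (tree_path y w)} = {M \<in> matchings E k. Q M}"
      using st(2) R by (auto simp: Q_def)
    then show ?thesis
      by simp
  qed
  moreover have "(\<Sum>x | {u, x} \<in> E. ?f x) = ?f y + (\<Sum>x\<in>{x. {u, x} \<in> E} - {y}. ?f x)"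
    using st(1) by (intro sum.remove) auto
  moreover have "(\<Sum>x\<in>{x. {u, x} \<in> E} - {y}. ?f x) = (\<Sum>x\<in>{x. {u, x} \<in> E} - {y}. - ?s * real (c x))"
    by (intro sum.cong) (auto simp: fx)
  moreover have "\<dots> = (\<Sum>x | {u, x} \<in> E. - ?s * real (c x))"
    using cy by (intro sum.mono_neutral_left) auto
  moreover have "\<dots> = - ?s * real (\<Sum>x | {u, x} \<in> E. c x)"
    by (simp add: sum_distrib_left)
  moreover have "(\<Sum>x | {u, x} \<in> E. c x) = card {M \<in> matchings E k. \<not> misses M u \<and> Q M}"
    unfolding c_def by (rule sum_card_matchings[OF simple])
  moreover have "card {M \<in> matchings E k. Q M} =
      card {M \<in> matchings E k. \<not> misses M u \<and> Q M} + card {M \<in> matchings E k. misses M u \<and> Q M}"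
    by (subst card_Un_disjoint[symmetric]) (auto intro: arg_cong[where f = card])
  moreover have "{M \<in> matchings E k. misses M u \<and> Q M} =
      {M \<in> matchings E k. R M \<and> misses M u \<and> alternates False M (tree_path u w)}"
    by (auto simp: Q_def p)
  ultimately show ?thesis
    by (simp add: algebra_simps)
qed

section \<open>Signed counting matrices and their products with \<open>A\<close>\<close>

definition signed_alternating :: "nat \<Rightarrow> real^'v^'v" where
  "signed_alternating k = (\<chi> u v. if even (length (tree_path u v))
     then - path_sign u v * real (card {M \<in> matchings E k. alternates True M (tree_path u v)}) else 0)"

definition signed_deficient :: "nat \<Rightarrow> real^'v^'v" where
  "signed_deficient k = (\<chi> u v. if odd (length (tree_path u v))
     then path_sign u v *
       real (card {M \<in> matchings E k. misses M v \<and> alternates True M (tree_path u v)}) else 0)"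

abbreviation A :: "real^'v^'v" where "A \<equiv> adjacency_matrix E"

lemma path_sign_commute: "path_sign v u = path_sign u v"
  by (simp add: path_sign_def tree_path_rev[of v u])

lemma transpose_adjacency_matrix: "transpose A = A"
  by (simp add: adjacency_matrix_def transpose_def vec_eq_iff insert_commute)

lemma signed_alternating_commute: "signed_alternating k $ v $ u = signed_alternating k $ u $ v"
  by (simp add: signed_alternating_def path_sign_commute[of v u] tree_path_rev[of v u]
      alternates_rev)

text \<open>Reading the path backwards puts the missed vertex at \<open>u\<close>, the form in which
  \<open>sum_neighbours_alternating\<close> delivers it.\<close>

lemma signed_deficient_swap:
  "signed_deficient k $ v $ u = (if odd (length (tree_path u v))
     then path_sign u v *
       real (card {M \<in> matchings E k. misses M u \<and> alternates False M (tree_path u v)}) else 0)"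
  by (simp add: signed_deficient_def path_sign_commute[of v u] tree_path_rev[of v u] alternates_rev)

lemma signed_deficient_commute: "signed_deficient k $ v $ u = signed_deficient k $ u $ v"
  using card_switch[of "tree_path u v" E k] tree_path_props[of u v]
  by (subst signed_deficient_swap) (simp add: signed_deficient_def)

lemma transpose_signed_deficient: "transpose (signed_deficient k) = signed_deficient k"
  by (simp add: transpose_def vec_eq_iff signed_deficient_commute)

lemma adjacency_mult: "(A ** B) $ u $ w = (\<Sum>x | {u, x} \<in> E. B $ x $ w)"
  by (simp add: matrix_matrix_mult_def adjacency_matrix_def if_distrib[of "\<lambda>x. x * _"]
      sum.inter_filter[symmetric] cong: if_cong)

lemma parity_step:
  assumes "tree_path u w = u # y # r" "{u, x} \<in> E"
  shows "even (length (tree_path x w)) \<longleftrightarrow> odd (length (tree_path u w))"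
  using tree_path_step(2)[OF assms(1)] tree_path_step(3)[OF assms] assms(1) by (cases "x = y") auto

lemma adjacency_mult_signed_alternating:
  "A ** signed_alternating k = real (card (matchings E k)) *\<^sub>R mat 1 - signed_deficient k"
proof -
  have "(\<Sum>x | {u, x} \<in> E. signed_alternating k $ x $ w) =
      real (card (matchings E k)) * (if u = w then 1 else 0) - signed_deficient k $ w $ u" for u w
  proof (cases "u = w")
    case True
    \<comment> \<open>The path from \<open>x\<close> to \<open>u\<close> is a single edge with
      \<open>path_sign\<close> -1, so the entry is a plain count.\<close>
    have "(\<Sum>x | {u, x} \<in> E. signed_alternating k $ x $ u) =
        (\<Sum>x | {u, x} \<in> E. real (card {M \<in> matchings E k. {u, x} \<in> M \<and> True}))"
      by (intro sum.cong) (auto simp: signed_alternating_def path_sign_def tree_path_adjacent insert_commute)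
    also have "\<dots> = real (card {M \<in> matchings E k. \<not> misses M u})"
      unfolding of_nat_sum[symmetric] sum_card_matchings[OF simple] by simp
    also have "\<dots> = real (card (matchings E k)) - real (card {M \<in> matchings E k. misses M u})"
    proof -
      have "card (matchings E k) =
          card {M \<in> matchings E k. \<not> misses M u} + card {M \<in> matchings E k. misses M u}"
        by (subst card_Un_disjoint[symmetric]) (auto intro: arg_cong[where f = card])
      then show ?thesis
        by simp
    qed
    finally show ?thesis
      using True by (simp add: signed_deficient_swap path_sign_def)
  next
    case False
    then obtain y r where p: "tree_path u w = u # y # r"
      by (rule tree_path_neq)
    show ?thesis
    proof (cases "odd (length (tree_path u w))")
      case odd: True
      \<comment> \<open>Odd length rules out \<open>r = []\<close>, so \<open>y\<close> is covered
        by the next edge of the path.\<close>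
      have notin: "{u, y} \<notin> M" if "M \<in> matchings E k" "True" "alternates True M (y # r)" for M
      proof (rule alternates_imp_notin)
        show "u \<notin> set (y # r)" "alternates True M (y # r)" "matching E M"
          using that tree_path_props(4)[of u w] p by (auto simp: matchings_def)
        show "misses M y" if "r = []"
          using that odd p by simp
      qed
      have "(\<Sum>x | {u, x} \<in> E. signed_alternating k $ x $ w) = - (\<Sum>x | {u, x} \<in> E. path_sign x w *
          real (card {M \<in> matchings E k. True \<and> alternates True M (tree_path x w)}))"
        unfolding sum_negf[symmetric] using odd parity_step[OF p]
        by (intro sum.cong) (auto simp: signed_alternating_def)
      also have "\<dots> = - path_sign y w *
          real (card {M \<in> matchings E k. True \<and> misses M u \<and> alternates False M (tree_path u w)})"
        using sum_neighbours_alternating[where R = "\<lambda>_. True" and k = k, OF p notin] by simp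
      also have "path_sign y w = path_sign u w"
        using odd p tree_path_step(2)[OF p] by (simp add: path_sign_def)
      finally show ?thesis
        using False odd by (simp add: signed_deficient_swap)
    next
      case even: False
      then have "(\<Sum>x | {u, x} \<in> E. signed_alternating k $ x $ w) = 0"
        using parity_step[OF p] by (intro sum.neutral) (auto simp: signed_alternating_def)
      then show ?thesis
        using False even by (simp add: signed_deficient_swap)
    qed
  qed
  then show ?thesis
    by (simp add: vec_eq_iff adjacency_mult mat_def signed_deficient_commute)
qed

lemma adjacency_mult_signed_deficient: "A ** signed_deficient k = signed_alternating (Suc k)"
proof -
  have "(\<Sum>x | {t, x} \<in> E. signed_deficient k $ x $ u) = signed_alternating (Suc k) $ t $ u" for t u
  proof (cases "t = u")
    case True
    then show ?thesis
      by (simp add: signed_alternating_def) (auto intro!: sum.neutral simp: signed_deficient_def tree_path_adjacent)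
  next
    case False
    then obtain y r where p: "tree_path t u = t # y # r"
      by (rule tree_path_neq)
    show ?thesis
    proof (cases "even (length (tree_path t u))")
      case even: True
      have notin: "{t, y} \<notin> M"
        if "M \<in> matchings E k" "misses M u" "alternates True M (y # r)" for M
      proof (rule alternates_imp_notin)
        show "t \<notin> set (y # r)" "alternates True M (y # r)" "matching E M"
          using that tree_path_props(4)[of t u] p by (auto simp: matchings_def)
        \<comment> \<open>Here \<open>y\<close> is the end vertex \<open>u\<close> itself, which
          \<open>M\<close> misses.\<close>
        show "misses M y" if "r = []"
          using that \<open>misses M u\<close> tree_path_props(3)[of t u] p by simp
      qed
      have "(\<Sum>x | {t, x} \<in> E. signed_deficient k $ x $ u) = (\<Sum>x | {t, x} \<in> E. path_sign x u *
          real (card {M \<in> matchings E k. misses M u \<and> alternates True M (tree_path x u)}))"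
        using even parity_step[OF p] by (intro sum.cong) (auto simp: signed_deficient_def)
      also have "\<dots> = path_sign y u *
          real (card {M \<in> matchings E k. misses M u \<and> misses M t \<and> alternates False M (tree_path t u)})"
        by (rule sum_neighbours_alternating[OF p notin])
      \<comment> \<open>Dropping one vertex from an even number lowers the halved length by one;
        from an odd number, as in the previous product, it does not.\<close>
      also have "path_sign y u = - path_sign t u"
        using even p tree_path_step(2)[OF p] by (auto simp: path_sign_def elim!: oddE)
      finally show ?thesis
        using even card_augment[of "tree_path t u" E k] tree_path_props[of t u] by (simp add: signed_alternating_def)
    next
      case odd: False
      then have "(\<Sum>x | {t, x} \<in> E. signed_deficient k $ x $ u) = 0"
        using parity_step[OF p] by (intro sum.neutral) (auto simp: signed_deficient_def)
      then show ?thesis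
        using odd by (simp add: signed_alternating_def)
    qed
  qed
  then show ?thesis
    by (simp add: vec_eq_iff adjacency_mult)
qed

section \<open>Maximum matchings and the generalized inverse\<close>

lemma matchings_maximum:
  obtains k where "matchings E k \<noteq> {}" "matchings E (Suc k) = {}"
    "\<And>M. maximum_matching E M \<longleftrightarrow> M \<in> matchings E k"
proof -
  let ?C = "card ` {M. matching E M}"
  have "matching E {}"
    by (simp add: matching_def)
  then have "finite ?C" "?C \<noteq> {}"
    by auto
  then have "\<forall>N. matching E N \<longrightarrow> card N \<le> Max ?C" "Max ?C \<in> ?C"
    by (simp_all add: Max_in)
  moreover from this(2) obtain M where M: "matching E M" "card M = Max ?C"
    by (elim imageE) simp
  ultimately have le: "card N \<le> card M" if "matching E N" for N
    using that by simp
  show thesis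
  proof
    show "matchings E (card M) \<noteq> {}"
      using M(1) by (auto simp: matchings_def)
    show "matchings E (Suc (card M)) = {}"
      using le by (fastforce simp: matchings_def)
    show "maximum_matching E N \<longleftrightarrow> N \<in> matchings E (card M)" for N
      unfolding maximum_matching_def matchings_def using le M(1)
      by (auto intro!: le_antisym)
  qed
qed

lemma penrose_inverse_adjacency:
  assumes "matchings E k \<noteq> {}" "matchings E (Suc k) = {}"
  shows "penrose_inverse A ((1 / real (card (matchings E k))) *\<^sub>R signed_alternating k)"
proof -
  let ?m = "real (card (matchings E k))"
  let ?B = "(1 / ?m) *\<^sub>R signed_alternating k"
  have m: "?m \<noteq> 0"
    using assms(1) by (simp add: card_eq_0_iff)
  have AW: "A ** signed_deficient k = 0"
    using assms(2) by (simp add: adjacency_mult_signed_deficient signed_alternating_def vec_eq_iff)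
  have WA: "signed_deficient k ** A = 0"
    using arg_cong[OF AW, of transpose]
    by (simp add: matrix_transpose_mul transpose_adjacency_matrix transpose_signed_deficient)
      (simp add: transpose_def vec_eq_iff)
  have "signed_deficient k ** signed_alternating k = 0"
  \<comment> \<open>Size 0 has no predecessor; there the empty matching contains no first edge, so
    \<open>signed_alternating k\<close> vanishes.\<close>
  proof (cases k)
    case 0
    have "\<not> alternates True M (tree_path u v)"
      if "M \<in> matchings E 0" "even (length (tree_path u v))" for M u v
      using that tree_path_props(1)[of u v]
      by (cases "tree_path u v" rule: remdups_adj.cases) (auto simp: matchings_def)
    then have "signed_alternating k = 0"
      by (auto simp: 0 signed_alternating_def vec_eq_iff)
    then show ?thesis
      by simp
  next
    case (Suc j)
    then have "signed_alternating k = A ** signed_deficient j"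
      by (simp add: adjacency_mult_signed_deficient)
    then show ?thesis
      by (simp add: matrix_mul_assoc WA)
  qed
  have AB: "A ** ?B = mat 1 - (1 / ?m) *\<^sub>R signed_deficient k"
    using m by (simp add: matrix_mult_scaleR adjacency_mult_signed_alternating scaleR_diff_right)
  then have sym: "transpose (A ** ?B) = A ** ?B"
    by (auto simp: transpose_def vec_eq_iff mat_def signed_deficient_commute)
  have "transpose ?B = ?B"
    by (simp add: transpose_def vec_eq_iff signed_alternating_commute)
  \<comment> \<open>Transposing the symmetric \<open>A ** ?B\<close> swaps its symmetric factors, so
    only two product equations remain to be checked.\<close>
  then have BA: "?B ** A = A ** ?B"
    using sym by (simp add: matrix_transpose_mul transpose_adjacency_matrix)
  have "A ** ?B ** A = A"
    unfolding AB by (simp add: matrix_diff_mult matrix_mult_scaleR WA)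
  moreover have "A ** ?B ** ?B = ?B"
    unfolding AB using \<open>signed_deficient k ** signed_alternating k = 0\<close>
    by (simp add: matrix_diff_mult matrix_mult_scaleR)
  ultimately show ?thesis
    using sym by (simp add: penrose_inverse_def BA)
qed

lemma signed_alternating_eq_mu:
  assumes "\<And>M. maximum_matching E M \<longleftrightarrow> M \<in> matchings E k"
  shows "signed_alternating k $ u $ v = real_of_int (mu E u v)"
proof (cases "even (length (tree_path u v))")
  case False
  then show ?thesis
    using tree_path_props(1)[of u v] by (simp add: signed_alternating_def mu_def graph_dist_eq)
next
  case True
  then have "u \<noteq> v"
    by auto
  \<comment> \<open>The distance is \<open>2 * n + 1\<close>, which is 1 mod 4 exactly for even
    \<open>n\<close>.\<close>
  obtain n where n: "length (tree_path u v) = 2 * Suc n"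
    using True tree_path_props(1)[of u v] by (elim evenE) (metis length_0_conv mult_0_right not0_implies_Suc)
  have "real_of_int (dist_sign E u v) = - path_sign u v"
    unfolding dist_sign_def path_sign_def graph_dist_eq n
    by (cases "even n") (auto elim!: evenE oddE)
  then show ?thesis
    using True \<open>u \<noteq> v\<close> n
    by (simp add: signed_alternating_def mu_def graph_dist_eq assms alternating_path_tree_iff)
qed

end

theorem theorem1:
  fixes E E' :: "'v::finite set set" and \<alpha>' :: "'v set \<Rightarrow> real" and u v :: 'v
  assumes "is_tree E"
    and "CARD('v) \<ge> 2"
    and "generalized_inverse_graph E = (E', \<alpha>')"
    and "u \<noteq> v"
  shows "({u, v} \<in> E' \<longleftrightarrow> (\<exists>M p. maximum_matching E M \<and> alternating_path E M u p v)) \<and>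
         ({u, v} \<in> E' \<longrightarrow> \<alpha>' {u, v} = real_of_int (mu E u v) / real (num_maximum_matchings E))"
proof -
  interpret tree E
    using assms(1) by unfold_locales
  obtain k where k: "matchings E k \<noteq> {}" "matchings E (Suc k) = {}"
    "\<And>M. maximum_matching E M \<longleftrightarrow> M \<in> matchings E k"
    using matchings_maximum by blast
  let ?m = "real (num_maximum_matchings E)"
  define B where "B = (1 / ?m) *\<^sub>R signed_alternating k"
  have m: "num_maximum_matchings E = card (matchings E k)"
    by (simp add: num_maximum_matchings_def k(3))
  have "generalized_inverse A = B"
    unfolding B_def m by (intro generalized_inverse_eqI transpose_adjacency_matrix penrose_inverse_adjacency k)
  then have graph: "E' = {{u, v} | u v. B $ u $ v \<noteq> 0}"
    "\<alpha>' = (\<lambda>e. THE x. \<exists>u v. e = {u, v} \<and> x = B $ u $ v)"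
    using assms(3) by (simp_all add: generalized_inverse_graph_def graph_of_matrix_def)
  have sym: "B $ v $ u = B $ u $ v" for u v
    by (simp add: B_def signed_alternating_commute)
  have B: "B $ u $ v = real_of_int (mu E u v) / ?m"
    by (simp add: B_def signed_alternating_eq_mu[OF k(3)])
  have "?m \<noteq> 0"
    using k(1) by (simp add: m card_eq_0_iff)
  then have "B $ u $ v \<noteq> 0 \<longleftrightarrow> signed_alternating k $ u $ v \<noteq> 0"
    by (simp add: B_def)
  \<comment> \<open>All matchings counted in one entry carry the same sign, so nothing
    cancels.\<close>
  also have "\<dots> \<longleftrightarrow> even (length (tree_path u v)) \<and> (\<exists>M\<in>matchings E k. alternates True M (tree_path u v))"
    by (auto simp: signed_alternating_def path_sign_def card_eq_0_iff)
  also have "\<dots> \<longleftrightarrow> (\<exists>M. maximum_matching E M \<and> (\<exists>p. alternating_path E M u p v))"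
    using assms(4) by (auto simp: k(3) alternating_path_tree_iff)
  finally have nz: "B $ u $ v \<noteq> 0 \<longleftrightarrow> (\<exists>M p. maximum_matching E M \<and> alternating_path E M u p v)"
    by blast
  have "{u, v} \<in> E' \<longleftrightarrow> B $ u $ v \<noteq> 0"
    using sym by (auto simp: graph doubleton_eq_iff)
  \<comment> \<open>By symmetry of \<open>B\<close> the two orderings of the pair give the same
    label.\<close>
  moreover have "\<alpha>' {u, v} = B $ u $ v"
    unfolding graph using sym by (intro the_equality) (auto simp: doubleton_eq_iff)
  ultimately show ?thesis
    using nz B by simp
qed

end
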